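(* Let $\mathcal{H}$ be a separable complex Hilbert space and let $\{\varphi_\theta:\theta\in\Theta\}$ be an arbitrary family of vector states in $\mathcal{H}$. There exists a statistic $T$ on $\mathcal{H}$ that is weakly sufficient for $\{\varphi_\theta:\theta\in\Theta\}$ if and only if for each $\theta\in\Theta$ there is a version $\widetilde{\varphi}_\theta$ of $\varphi_\theta$ such that for all $\theta',\theta''\in\Theta$ $$\langle\widetilde{\varphi}_{\theta'},\widetilde{\varphi}_{\theta''}\rangle\in\mathbb{R}.$$
   Context: A vector state is a unit vector $\varphi\in\mathcal{H}$. A version of a vector $\varphi$ is a vector $\widetilde{\varphi}=c\varphi$ with $c\in\mathbb{C}$, $|c|=1$. A (quantum) statistic is a (possibly unbounded) selfadjoint operator $T=\int_{-\infty}^{\infty}\lambda\,e(d\lambda)$ on $\mathcal{H}$, where $e$ is its spectral measure on the Borel sets of $\mathbb{R}$; for a Borel function $\Phi\colon\mathbb{R}\to\mathbb{R}$, $\Phi(T)=\int_{-\infty}^{\infty}\Phi(\lambda)\,e(d\lambda)$ (Borel functional calculus). A statistic $T$ is weakly sufficient for $\{\varphi_\theta:\theta\in\Theta\}$ if there exist Borel functions $\Phi_\theta\colon\mathbb{R}\to\mathbb{R}$ ($\theta\in\Theta$), a vector $\chi\in\mathcal{H}$ (which may be taken to be a unit vector; the normalization is inessential), and a version $\widetilde{\varphi}_\theta$ of $\varphi_\theta$ for each $\theta\in\Theta$, such that $\widetilde{\varphi}_\theta=\Phi_\theta(T)\chi$ for all $\theta\in\Theta$ (in particular $\chi$ lies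 in the domain of each $\Phi_\theta(T)$). *)

theory Defs
  imports "HOL-Analysis.Analysis"
begin

(* Complex inner product spaces are built on top of the class of real inner product spaces: the
   real inner product is the real part of the complex one, so that norm x = sqrt (Re (cinner x x)),
   and the topology and the norm are those of the library.  The form cinner is linear in its
   second argument and conjugate-linear in its first. *)

class complex_inner = real_inner +
  fixes scaleC :: "complex \<Rightarrow> 'a \<Rightarrow> 'a"  (infixr \<open>*\<^sub>C\<close> 75)
    and cinner :: "'a \<Rightarrow> 'a \<Rightarrow> complex"
  assumes scaleC_add_right: "a *\<^sub>C (x + y) = a *\<^sub>C x + a *\<^sub>C y"
    and scaleC_add_left: "(a + b) *\<^sub>C x = a *\<^sub>C x + b *\<^sub>C x"
    and scaleC_scaleC: "a *\<^sub>C b *\<^sub>C x = (a * b) *\<^sub>C x"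
    and scaleR_scaleC: "r *\<^sub>R x = complex_of_real r *\<^sub>C x"
    and cinner_commute: "cinner x y = cnj (cinner y x)"
    and cinner_add_right: "cinner x (y + z) = cinner x y + cinner x z"
    and cinner_scaleC_right: "cinner x (a *\<^sub>C y) = a * cinner x y"
    and inner_eq_Re_cinner: "inner x y = Re (cinner x y)"

class complex_hilbert_space = complex_inner + complete_space

definition is_version :: "'a::complex_inner \<Rightarrow> 'a \<Rightarrow> bool" where
  "is_version \<psi> \<phi> \<longleftrightarrow> (\<exists>c. cmod c = 1 \<and> \<psi> = c *\<^sub>C \<phi>)"

(* A possibly unbounded operator is identified with its graph; its domain is the Domain of the
   graph. *)

type_synonym 'a graph = "('a \<times> 'a) set"

definition linear_operator :: "'a::complex_inner graph \<Rightarrow> bool" where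
  "linear_operator T \<longleftrightarrow>
     single_valued T \<and> (0, 0) \<in> T \<and>
     (\<forall>x y x' y'. (x, y) \<in> T \<longrightarrow> (x', y') \<in> T \<longrightarrow> (x + x', y + y') \<in> T) \<and>
     (\<forall>c x y. (x, y) \<in> T \<longrightarrow> (c *\<^sub>C x, c *\<^sub>C y) \<in> T)"

definition adjoint_operator :: "'a::complex_inner graph \<Rightarrow> 'a graph" where
  "adjoint_operator T = {(y, z). \<forall>(x, w) \<in> T. cinner y w = cinner z x}"

definition selfadjoint :: "'a::complex_inner graph \<Rightarrow> bool" where
  "selfadjoint T \<longleftrightarrow>
     linear_operator T \<and> closure (Domain T) = UNIV \<and> adjoint_operator T = T"

(* Boundedness of a projection is a consequence of the conditions below. *)

definition orthogonal_projection :: "('a::complex_inner \<Rightarrow> 'a) \<Rightarrow> bool" where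
  "orthogonal_projection P \<longleftrightarrow>
     (\<forall>x y. P (x + y) = P x + P y) \<and> (\<forall>c x. P (c *\<^sub>C x) = c *\<^sub>C P x) \<and>
     (\<forall>x. P (P x) = P x) \<and> (\<forall>x y. cinner (P x) y = cinner x (P y))"

(* Countable additivity is in the strong operator topology; e {} = 0 and e (A \<inter> B) = e A \<circ> e B
   for Borel sets A and B follow. *)

definition spectral_measure :: "(real set \<Rightarrow> 'a::complex_hilbert_space \<Rightarrow> 'a) \<Rightarrow> bool" where
  "spectral_measure e \<longleftrightarrow>
     (\<forall>A \<in> sets borel. orthogonal_projection (e A)) \<and>
     (\<forall>x. e UNIV x = x) \<and>
     (\<forall>A x. range A \<subseteq> sets borel \<longrightarrow> disjoint_family A \<longrightarrow>
        (\<lambda>n::nat. e (A n) x) sums e (\<Union>n. A n) x)"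

definition scalar_measure ::
    "(real set \<Rightarrow> 'a::complex_hilbert_space \<Rightarrow> 'a) \<Rightarrow> 'a \<Rightarrow> real measure" where
  "scalar_measure e x = measure_of UNIV (sets borel) (\<lambda>A. ennreal (Re (cinner x (e A x))))"

definition simple_spectral_integral ::
    "(real set \<Rightarrow> 'a::complex_hilbert_space \<Rightarrow> 'a) \<Rightarrow> (real \<Rightarrow> real) \<Rightarrow> 'a \<Rightarrow> 'a" where
  "simple_spectral_integral e s x = (\<Sum>c \<in> range s. c *\<^sub>R e (s -` {c}) x)"

(* The graph of the operator given by integrating \<Phi> against e.  Its domain consists of all x with
   \<Phi> square integrable for the measure A \<mapsto> <x, e(A) x>.  For such x, the isometry that sends a
   simple function s, as an element of L2 of this measure, to the vector obtained by integrating s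
   against e and applying the result to x extends to all of L2 by continuity; y is the image
   of \<Phi>. *)

definition spectral_integral ::
    "(real set \<Rightarrow> 'a::complex_hilbert_space \<Rightarrow> 'a) \<Rightarrow> (real \<Rightarrow> real) \<Rightarrow> 'a graph" where
  "spectral_integral e \<Phi> = {(x, y).
     (\<integral>\<^sup>+ t. ennreal ((\<Phi> t)\<^sup>2) \<partial>scalar_measure e x) < \<infinity> \<and>
     (\<exists>s :: nat \<Rightarrow> real \<Rightarrow> real.
        (\<forall>n. simple_function borel (s n)) \<and>
        (\<lambda>n. \<integral>\<^sup>+ t. ennreal ((s n t - \<Phi> t)\<^sup>2) \<partial>scalar_measure e x) \<longlonglongrightarrow> 0 \<and>
        (\<lambda>n. simple_spectral_integral e (s n) x) \<longlonglongrightarrow> y)}"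

definition is_spectral_measure_of ::
    "(real set \<Rightarrow> 'a::complex_hilbert_space \<Rightarrow> 'a) \<Rightarrow> 'a graph \<Rightarrow> bool" where
  "is_spectral_measure_of e T \<longleftrightarrow> spectral_measure e \<and> T = spectral_integral e (\<lambda>t. t)"

(* By the spectral theorem a self-adjoint T has exactly one spectral measure e, and then
   spectral_integral e (\<Phi> \<theta>) is the operator obtained by applying the Borel function \<Phi> \<theta> to T. *)

definition weakly_sufficient ::
    "'a::complex_hilbert_space graph \<Rightarrow> 'i set \<Rightarrow> ('i \<Rightarrow> 'a) \<Rightarrow> bool" where
  "weakly_sufficient T \<Theta> \<phi> \<longleftrightarrow>
     (\<exists>e. is_spectral_measure_of e T \<and>
       (\<exists>(\<Phi> :: 'i \<Rightarrow> real \<Rightarrow> real) \<xi> \<phi>'. \<forall>\<theta>\<in>\<Theta>.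
          \<Phi> \<theta> \<in> borel_measurable borel \<and>
          is_version (\<phi>' \<theta>) (\<phi> \<theta>) \<and>
          (\<xi>, \<phi>' \<theta>) \<in> spectral_integral e (\<Phi> \<theta>)))"

end

theory Submission
  imports Defs
begin

text \<open>Vectors obtained by integrating real functions against one spectral measure and evaluating at
  one vector \<open>\<xi>\<close> are limits of real linear combinations of vectors \<open>e A \<xi>\<close>, and
  \<open>\<langle>e A \<xi>, e B \<xi>\<rangle> = \<parallel>e (A \<inter> B) \<xi>\<parallel>\<^sup>2\<close> is real. Conversely, orthonormalizing a countable dense part of
  a family with real inner products takes only real combinations, so the family has real Fourier
  coefficients in the resulting orthonormal sequence. An operator that is diagonal in this sequence
  with distinct eigenvalues, together with a vector all of whose coefficients are nonzero reals,
  then represents every member of the family by a real function of the operator.\<close>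

subsection \<open>Complex inner products\<close>

\<comment> \<open>This makes the comparison test for series of vectors available.\<close>
subclass (in complex_hilbert_space) banach ..

lemma scaleC_one [simp]: "1 *\<^sub>C x = (x::'a::complex_inner)"
  using scaleR_scaleC[of 1 x] by simp

lemma scaleC_of_real: "of_real r *\<^sub>C x = r *\<^sub>R (x::'a::complex_inner)"
  by (simp add: scaleR_scaleC)

lemma scaleC_scaleR: "a *\<^sub>C (r *\<^sub>R x) = r *\<^sub>R (a *\<^sub>C (x::'a::complex_inner))"
  by (simp add: scaleR_scaleC scaleC_scaleC mult.commute)

lemma cinner_scaleR_right: "cinner x (r *\<^sub>R y) = of_real r * cinner x (y::'a::complex_inner)"
  by (simp add: scaleR_scaleC cinner_scaleC_right)

lemma cinner_scaleC_left: "cinner (a *\<^sub>C x) y = cnj a * cinner x (y::'a::complex_inner)"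
  by (metis cinner_commute cinner_scaleC_right complex_cnj_mult)

lemma cinner_scaleR_left: "cinner (r *\<^sub>R x) y = of_real r * cinner x (y::'a::complex_inner)"
  by (simp add: scaleR_scaleC cinner_scaleC_left)

lemma cinner_add_left: "cinner (x + y) z = cinner x z + cinner y (z::'a::complex_inner)"
  by (metis cinner_commute cinner_add_right complex_cnj_add)

lemma cinner_self: "cinner x x = of_real ((norm (x::'a::complex_inner))\<^sup>2)"
proof (rule complex_eqI)
  show "Im (cinner x x) = Im (of_real ((norm x)\<^sup>2))"
    using arg_cong[OF cinner_commute[of x x], of Im] by simp
qed (simp add: power2_norm_eq_inner inner_eq_Re_cinner)

lemma norm_scaleC: "norm (c *\<^sub>C x) = cmod c * norm (x::'a::complex_inner)"
proof -
  have "complex_of_real ((norm (c *\<^sub>C x))\<^sup>2) = of_real ((cmod c * norm x)\<^sup>2)"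
    unfolding cinner_self[symmetric] cinner_scaleC_right cinner_scaleC_left
    by (simp add: cinner_self power_mult_distrib complex_norm_square[symmetric] mult_ac)
  then show ?thesis
    by (metis mult_nonneg_nonneg norm_ge_zero of_real_eq_iff power2_eq_iff_nonneg)
qed

text \<open>The imaginary part is, up to sign, the real inner product with
  \<open>\<i> *\<^sub>C y\<close>, so real Cauchy-Schwarz bounds both parts. The crude constant
  \<open>2\<close> suffices for continuity of the form.\<close>

lemma norm_cinner_le: "cmod (cinner x y) \<le> norm x * norm (y::'a::complex_inner) * 2"
proof -
  have "cinner x (\<i> *\<^sub>C y) = \<i> * cinner x y"
    by (rule cinner_scaleC_right)
  then have "Im (cinner x y) = - inner x (\<i> *\<^sub>C y)"
    by (simp add: inner_eq_Re_cinner)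
  then have "\<bar>Im (cinner x y)\<bar> \<le> norm x * norm y"
    using Cauchy_Schwarz_ineq2[of x "\<i> *\<^sub>C y"] by (simp add: norm_scaleC)
  moreover have "\<bar>Re (cinner x y)\<bar> \<le> norm x * norm y"
    using Cauchy_Schwarz_ineq2[of x y] by (simp add: inner_eq_Re_cinner)
  ultimately show ?thesis
    using cmod_le[of "cinner x y"] by simp
qed

lemma bounded_bilinear_cinner: "bounded_bilinear (cinner :: 'a::complex_inner \<Rightarrow> 'a \<Rightarrow> complex)"
proof
  show "\<exists>K. \<forall>a b::'a. cmod (cinner a b) \<le> norm a * norm b * K"
    using norm_cinner_le by blast
qed (simp_all add: cinner_add_left cinner_add_right cinner_scaleR_left cinner_scaleR_right
    scaleR_conv_of_real)

lemma bounded_bilinear_scaleC: "bounded_bilinear (scaleC :: complex \<Rightarrow> 'a::complex_inner \<Rightarrow> 'a)"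
proof
  show "\<exists>K. \<forall>a (b::'a). norm (a *\<^sub>C b) \<le> norm a * norm b * K"
    by (metis mult.right_neutral norm_scaleC order_refl)
qed (simp_all add: scaleC_add_left scaleC_add_right scaleC_scaleR scaleR_scaleC scaleC_scaleC
    scaleR_conv_of_real mult.commute)

interpretation cinner: bounded_bilinear "cinner :: 'a::complex_inner \<Rightarrow> 'a \<Rightarrow> complex"
  by (rule bounded_bilinear_cinner)

interpretation scaleC: bounded_bilinear "scaleC :: complex \<Rightarrow> 'a::complex_inner \<Rightarrow> 'a"
  by (rule bounded_bilinear_scaleC)

lemma cinner_ext: "(\<And>u. cinner x u = cinner y u) \<Longrightarrow> x = (y::'a::complex_inner)"
  using cinner_self[of "x - y"] by (simp add: cinner.diff_left)

lemma cinner_in_Reals_commute: "cinner x y \<in> \<real> \<longleftrightarrow> cinner y (x::'a::complex_inner) \<in> \<real>"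
  by (metis Reals_cnj_iff cinner_commute)

lemma cinner_in_Reals_eq: "cinner x y \<in> \<real> \<Longrightarrow> cinner x y = of_real (inner x (y::'a::complex_inner))"
  by (simp add: inner_eq_Re_cinner)

text \<open>By Pythagoras, the squared norm of a finite block of the series is a difference of
  partial sums of squared norms, so the Cauchy property carries over to \<open>f\<close>. Summation
  is unordered because spectral projections later sum over arbitrary index sets.\<close>

lemma orthogonal_summable_on:
  fixes f :: "'i \<Rightarrow> 'a::complex_hilbert_space"
  assumes orth: "pairwise (\<lambda>i j. orthogonal (f i) (f j)) A"
    and bound: "\<And>F. finite F \<Longrightarrow> F \<subseteq> A \<Longrightarrow> (\<Sum>i\<in>F. (norm (f i))\<^sup>2) \<le> C"
  shows "f summable_on A"
proof -
  let ?g = "\<lambda>i. (norm (f i))\<^sup>2"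
  have "?g summable_on A"
    by (rule nonneg_bdd_above_summable_on) (auto intro!: bdd_aboveI[of _ C] bound)
  then have cau: "cauchy_filter (filtermap (sum ?g) (finite_subsets_at_top A))"
    unfolding summable_on_def has_sum_def
    by (auto simp: filterlim_def intro: nhds_imp_cauchy_filter)
  have "cauchy_filter (filtermap (sum f) (finite_subsets_at_top A))"
    unfolding cauchy_filter_metric_filtermap
  proof (intro allI impI)
    fix \<epsilon> :: real assume "\<epsilon> > 0"
    \<comment> \<open>The tolerance is squared because Pythagoras controls squared distances, and
      halved because two partial sums are compared through \<open>F0\<close>.\<close>
    then have pos: "(\<epsilon> / 2)\<^sup>2 > 0" by simp
    have "\<exists>Q. eventually Q (finite_subsets_at_top A) \<and>
        (\<forall>F G. Q F \<and> Q G \<longrightarrow> dist (sum ?g F) (sum ?g G) < (\<epsilon> / 2)\<^sup>2)"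
      by (rule cauchy_filter_metric_filtermap[THEN iffD1, OF cau, THEN spec, THEN mp, OF pos])
    then obtain Q where Q: "eventually Q (finite_subsets_at_top A) \<and>
        (\<forall>F G. Q F \<and> Q G \<longrightarrow> dist (sum ?g F) (sum ?g G) < (\<epsilon> / 2)\<^sup>2)" ..
    from Q[THEN conjunct1] obtain F0 where "finite F0 \<and> F0 \<subseteq> A \<and>
        (\<forall>F. finite F \<and> F0 \<subseteq> F \<and> F \<subseteq> A \<longrightarrow> Q F)"
      unfolding eventually_finite_subsets_at_top ..
    then have F0: "finite F0" "F0 \<subseteq> A"
      "\<And>F. finite F \<Longrightarrow> F0 \<subseteq> F \<Longrightarrow> F \<subseteq> A \<Longrightarrow> Q F"
      by simp_all
    have close: "dist (sum f F) (sum f F0) < \<epsilon> / 2" if F: "finite F" "F0 \<subseteq> F" "F \<subseteq> A" for F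
    proof -
      have "(dist (sum f F) (sum f F0))\<^sup>2 = (norm (sum f (F - F0)))\<^sup>2"
        using F by (simp add: dist_norm sum_diff)
      also have "\<dots> = sum ?g (F - F0)"
        using F orth by (intro norm_sum_Pythagorean) (auto intro: pairwise_subset)
      also have "\<dots> = sum ?g F - sum ?g F0"
        using F by (simp add: sum_diff)
      also have "\<dots> < (\<epsilon> / 2)\<^sup>2"
        using Q[THEN conjunct2, rule_format, OF conjI[OF F0(3)[OF F] F0(3)[OF F0(1) order_refl F0(2)]]]
        by (simp add: dist_real_def)
      finally show ?thesis
        by (rule power_less_imp_less_base) (use \<open>\<epsilon> > 0\<close> in simp)
    qed
    show "\<exists>P. eventually P (finite_subsets_at_top A) \<and>
        (\<forall>F G. P F \<and> P G \<longrightarrow> dist (sum f F) (sum f G) < \<epsilon>)"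
    proof (rule exI[of _ "\<lambda>F. finite F \<and> F0 \<subseteq> F \<and> F \<subseteq> A"], rule conjI)
      show "\<forall>\<^sub>F F in finite_subsets_at_top A. finite F \<and> F0 \<subseteq> F \<and> F \<subseteq> A"
        unfolding eventually_finite_subsets_at_top using F0(1,2) by (intro exI[of _ F0]) simp
      show "\<forall>F G. (finite F \<and> F0 \<subseteq> F \<and> F \<subseteq> A) \<and> finite G \<and> F0 \<subseteq> G \<and> G \<subseteq> A \<longrightarrow>
          dist (sum f F) (sum f G) < \<epsilon>"
      proof (intro allI impI, elim conjE)
        fix F G assume "finite F" "F0 \<subseteq> F" "F \<subseteq> A" "finite G" "F0 \<subseteq> G" "G \<subseteq> A"
        then show "dist (sum f F) (sum f G) < \<epsilon>"
          using dist_triangle_half_l[OF close[of F] close[of G]] by simp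
      qed
    qed
  qed
  then obtain l where "(sum f \<longlongrightarrow> l) (finite_subsets_at_top A)"
    using convergent_filter_iff_cauchy by (auto simp: convergent_filter_iff filterlim_def)
  then show ?thesis
    by (auto simp: summable_on_def has_sum_def)
qed

section \<open>Orthogonal projections as bounded operators\<close>

lemma orthogonal_projectionD:
  assumes "orthogonal_projection P"
  shows "P (x + y) = P x + P y" "P (c *\<^sub>C x) = c *\<^sub>C P x" "P (P x) = P x"
    "cinner (P x) y = cinner x (P y)"
  using assms unfolding orthogonal_projection_def by auto

lemma orthogonal_projection_norm_sq:
  assumes "orthogonal_projection P"
  shows "cinner x (P x) = of_real ((norm (P x))\<^sup>2)"
  by (metis assms cinner_self orthogonal_projectionD(3,4))

lemma orthogonal_projection_norm_le:
  assumes "orthogonal_projection P"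
  shows "norm (P x) \<le> norm x"
proof -
  have "(norm (P x))\<^sup>2 = inner x (P x)"
    by (simp add: inner_eq_Re_cinner orthogonal_projection_norm_sq[OF assms])
  also have "\<dots> \<le> norm x * norm (P x)"
    by (rule norm_cauchy_schwarz)
  finally show ?thesis
    by (cases "P x = 0") (auto simp: power2_eq_square)
qed

lemma orthogonal_projection_bounded_linear:
  assumes "orthogonal_projection P"
  shows "bounded_linear P"
  by (rule bounded_linear_intro[where K = 1])
    (auto simp: orthogonal_projectionD[OF assms] scaleR_scaleC
      intro: orthogonal_projection_norm_le[OF assms])

subsection \<open>Real inner products from weak sufficiency\<close>

lemma spectral_measure_projection:
  "spectral_measure e \<Longrightarrow> A \<in> sets borel \<Longrightarrow> orthogonal_projection (e A)"
  unfolding spectral_measure_def by blast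

text \<open>Empty sets form a disjoint sequence, so a constant series converges, which forces its
  term to vanish.\<close>

lemma spectral_measure_empty:
  assumes "spectral_measure e"
  shows "e {} x = 0"
proof -
  have "(\<lambda>n::nat. e {} x) sums e (\<Union>n::nat. {}) x"
    using assms unfolding spectral_measure_def by (auto simp: disjoint_family_on_def)
  then show ?thesis
    using sums_summable summable_const_iff by blast
qed

lemma spectral_measure_Un:
  assumes "spectral_measure e" "A \<in> sets borel" "B \<in> sets borel" "A \<inter> B = {}"
  shows "e (A \<union> B) x = e A x + e B x"
proof -
  have "range (binaryset A B) \<subseteq> sets borel" "disjoint_family (binaryset A B)"
    using assms by (auto simp: range_binaryset_eq disjoint_family_on_def binaryset_def)
  then have "(\<lambda>n. e (binaryset A B n) x) sums e (A \<union> B) x"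
    using assms(1) UN_binaryset_eq[of A B] unfolding spectral_measure_def by metis
  moreover have "(\<lambda>n. e (binaryset A B n) x) sums (\<Sum>n\<in>{0,1}. e (binaryset A B n) x)"
    by (rule sums_finite) (auto simp: binaryset_def spectral_measure_empty[OF assms(1)])
  ultimately show ?thesis
    by (auto dest: sums_unique2 simp: binaryset_def)
qed

text \<open>If \<open>P + Q\<close> is idempotent then \<open>P Q = - Q P\<close>; multiplying by \<open>P\<close> on either side gives
  \<open>P Q = Q P\<close>.\<close>

lemma spectral_measure_disjoint:
  assumes e: "spectral_measure e" and A: "A \<in> sets borel" and B: "B \<in> sets borel"
    and disj: "A \<inter> B = {}"
  shows "e A (e B x) = 0"
proof -
  note PA = orthogonal_projectionD[OF spectral_measure_projection[OF e A]]
  note PB = orthogonal_projectionD[OF spectral_measure_projection[OF e B]]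
  have PU: "orthogonal_projection (e (A \<union> B))"
    using A B by (intro spectral_measure_projection[OF e]) auto
  have anti: "e A (e B y) = - e B (e A y)" for y
  proof -
    have "e A y + e B y = e (A \<union> B) (e (A \<union> B) y)"
      using orthogonal_projectionD(3)[OF PU] spectral_measure_Un[OF e A B disj] by simp
    also have "\<dots> = e A y + e A (e B y) + (e B (e A y) + e B y)"
      by (simp add: spectral_measure_Un[OF e A B disj] PA PB)
    finally have "e A (e B y) + e B (e A y) = 0"
      by (simp add: algebra_simps)
    then show ?thesis
      by (rule add_eq_0_iff2[THEN iffD1])
  qed
  have "e A (e B x) = - e A (e B (e A x))"
    using arg_cong[OF anti[of x], of "e A"] PA(3)[of "e B x"] linear_neg[OF bounded_linear.linear[OF
      orthogonal_projection_bounded_linear[OF spectral_measure_projection[OF e A]]]] by simp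
  moreover have "e A (e B (e A x)) = - e B (e A x)"
    using anti[of "e A x"] PA(3) by simp
  ultimately have "2 *\<^sub>R e A (e B x) = 0"
    unfolding scaleR_2 using anti[of x] by (metis add.right_inverse minus_minus)
  then show ?thesis by simp
qed

text \<open>Splitting \<open>A\<close> and \<open>B\<close> along their intersection
  \<open>C\<close> leaves, by orthogonality over disjoint sets, only the squared norm of
  \<open>e C x\<close>.\<close>

lemma spectral_measure_cinner_Reals:
  assumes e: "spectral_measure e" and A: "A \<in> sets borel" and B: "B \<in> sets borel"
  shows "cinner (e A x) (e B x) \<in> \<real>"
proof -
  define C where "C = A \<inter> B"
  have C: "C \<in> sets borel" "A - C \<in> sets borel" "B - C \<in> sets borel"
    using A B by (auto simp: C_def)
  have disj: "C \<inter> (B - C) = {}" "(A - C) \<inter> C = {}" "(A - C) \<inter> (B - C) = {}"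
    by (auto simp: C_def)
  have zero: "cinner (e D x) (e E x) = 0" if "D \<in> sets borel" "E \<in> sets borel" "D \<inter> E = {}" for D E
    using spectral_measure_disjoint[OF e that]
      orthogonal_projectionD(4)[OF spectral_measure_projection[OF e that(1)]]
    by (simp add: cinner.zero_right)
  have "e A x = e C x + e (A - C) x" "e B x = e C x + e (B - C) x"
    using spectral_measure_Un[OF e C(1,2), of x] spectral_measure_Un[OF e C(1,3), of x]
    by (auto simp: C_def Un_Diff_cancel sup.absorb2)
  then have "cinner (e A x) (e B x) = cinner (e C x) (e C x)"
    using zero[OF C(1,3)] zero[OF C(2,1)] zero[OF C(2,3)] disj
    by (simp add: cinner_add_left cinner_add_right)
  then show ?thesis
    by (simp add: cinner_self)
qed

text \<open>For simple functions the inner product is a real combination of real numbers. The limit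
  stays real because \<open>cinner\<close> is continuous and the reals are closed.\<close>

lemma spectral_integral_cinner_Reals:
  assumes e: "spectral_measure e"
    and y: "(x, y) \<in> spectral_integral e \<Phi>" and z: "(x, z) \<in> spectral_integral e \<Psi>"
  shows "cinner y z \<in> \<real>"
proof -
  obtain s where s: "\<And>n. simple_function borel (s n)"
    "(\<lambda>n::nat. simple_spectral_integral e (s n) x) \<longlonglongrightarrow> y"
    using y unfolding spectral_integral_def by auto
  obtain t where t: "\<And>n. simple_function borel (t n)"
    "(\<lambda>n::nat. simple_spectral_integral e (t n) x) \<longlonglongrightarrow> z"
    using z unfolding spectral_integral_def by auto
  have *: "cinner (simple_spectral_integral e (s n) x) (simple_spectral_integral e (t n) x) \<in> \<real>" for n
    unfolding simple_spectral_integral_def cinner.sum_left cinner.sum_right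
    using simple_functionD(2)[OF s(1), of n] simple_functionD(2)[OF t(1), of n]
    by (auto simp: cinner_scaleR_left cinner_scaleR_right
        intro!: sum_in_Reals Reals_mult spectral_measure_cinner_Reals[OF e])
  show ?thesis
    by (rule Lim_in_closed_set[OF closed_complex_Reals _ _ cinner.tendsto[OF s(2) t(2)]])
      (use * in auto)
qed

subsection \<open>Diagonal spectral measures\<close>

text \<open>\<open>P n\<close> is to be the eigenprojection for the eigenvalue
  \<open>real n\<close>. Individual projections may be zero, which accommodates finite-dimensional
  spaces.\<close>

locale projection_resolution =
  fixes P :: "nat \<Rightarrow> 'a::complex_hilbert_space \<Rightarrow> 'a"
  assumes proj: "orthogonal_projection (P n)"
    and P_P_neq: "m \<noteq> n \<Longrightarrow> P m (P n x) = 0"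
    and P_sums: "(\<lambda>n. P n x) sums x"
begin

lemmas bounded_linear_P = orthogonal_projection_bounded_linear[OF proj]

lemmas linear_P = bounded_linear.linear[OF bounded_linear_P]

lemma P_P: "P m (P n x) = (if m = n then P n x else 0)"
  by (simp add: P_P_neq orthogonal_projectionD(3)[OF proj])

lemma P_scaleC: "P n (c *\<^sub>C x) = c *\<^sub>C P n x"
  by (rule orthogonal_projectionD(2)[OF proj])

text \<open>Later identities between vectors are checked one component at a time through this
  rule.\<close>

lemma P_ext:
  assumes "\<And>n. P n x = P n y"
  shows "x = y"
  using sums_unique2[OF P_sums[of x]] P_sums[of y] assms by simp

lemma cinner_P: "cinner x (P n y) = cinner (P n x) (P n y)"
  by (simp add: orthogonal_projectionD[OF proj])

text \<open>Parseval's identity, from applying the continuous functional \<open>cinner x\<close> to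
  the expansion of \<open>y\<close>.\<close>

lemma cinner_sums: "(\<lambda>n. cinner (P n x) (P n y)) sums cinner x y"
  using bounded_linear.sums[OF cinner.bounded_linear_right P_sums, of x y]
  by (simp add: cinner_P[symmetric])

lemma norm_sums: "(\<lambda>n. (norm (P n x))\<^sup>2) sums (norm x)\<^sup>2"
  using sums_Re[OF cinner_sums[of x x]] by (simp only: cinner_self Re_complex_of_real)

lemma P_summable_on: "(\<lambda>n. P n x) summable_on A"
proof (rule orthogonal_summable_on)
  show "pairwise (\<lambda>m n. orthogonal (P m x) (P n x)) A"
    by (auto simp: pairwise_def orthogonal_def inner_eq_Re_cinner
        orthogonal_projectionD(4)[OF proj] P_P cinner.zero_right)
  show "(\<Sum>n\<in>F. (norm (P n x))\<^sup>2) \<le> (norm x)\<^sup>2" if "finite F" for F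
    using sum_le_suminf[OF sums_summable[OF norm_sums[of x]] that] sums_unique[OF norm_sums[of x]]
    by simp
qed

text \<open>The pure point spectral measure of the operator that multiplies the range of
  \<open>P n\<close> by \<open>real n\<close>.\<close>

definition diag_measure :: "real set \<Rightarrow> 'a \<Rightarrow> 'a" where
  "diag_measure A x = infsum (\<lambda>n. P n x) {n. real n \<in> A}"

lemma diag_measure_has_sum: "((\<lambda>n. P n x) has_sum diag_measure A x) {n. real n \<in> A}"
  unfolding diag_measure_def by (rule has_sum_infsum[OF P_summable_on])

lemma P_diag_measure: "P m (diag_measure A x) = (if real m \<in> A then P m x else 0)"
proof -
  have "((\<lambda>n. P m (P n x)) has_sum P m (diag_measure A x)) {n. real n \<in> A}"
    by (rule has_sum_bounded_linear[OF bounded_linear_P diag_measure_has_sum])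
  moreover have "((\<lambda>n. P m (P n x)) has_sum (if real m \<in> A then P m x else 0)) {n. real n \<in> A}"
    by (rule has_sum_finite_neutralI[of "{m} \<inter> {n. real n \<in> A}"]) (auto simp: P_P)
  ultimately show ?thesis
    by (rule has_sum_unique)
qed

lemma spectral_measure_diag_measure: "spectral_measure diag_measure"
  unfolding spectral_measure_def
proof (intro conjI ballI allI impI)
  fix A :: "real set"
  show "orthogonal_projection (diag_measure A)"
    unfolding orthogonal_projection_def
  proof (intro conjI allI)
    show "diag_measure A (x + y) = diag_measure A x + diag_measure A y" for x y
      by (rule P_ext) (simp add: P_diag_measure linear_add[OF linear_P])
    show "diag_measure A (c *\<^sub>C x) = c *\<^sub>C diag_measure A x" for c x
      by (rule P_ext) (simp add: P_diag_measure P_scaleC scaleC.zero_right)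
    show "diag_measure A (diag_measure A x) = diag_measure A x" for x
      by (rule P_ext) (simp add: P_diag_measure)
    have "(\<lambda>n. cinner (P n (diag_measure A x)) (P n y)) =
        (\<lambda>n. cinner (P n x) (P n (diag_measure A y)))" for x y
      by (simp add: fun_eq_iff P_diag_measure cinner.zero_left cinner.zero_right)
    then show "cinner (diag_measure A x) y = cinner x (diag_measure A y)" for x y
      using sums_unique2[OF cinner_sums[of "diag_measure A x" y]]
        cinner_sums[of x "diag_measure A y"] by simp
  qed
next
  show "diag_measure UNIV x = x" for x
    by (rule P_ext) (simp add: P_diag_measure)
next
  fix A :: "nat \<Rightarrow> real set" and x
  assume disj: "disjoint_family A"
  \<comment> \<open>Countable additivity is a regrouping of an unordered sum: disjointness makes
    each index \<open>n\<close> in the union belong to exactly one pair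
    \<open>(k, n)\<close>.\<close>
  have "((\<lambda>n. P n x) has_sum diag_measure (\<Union>n. A n) x)
      (snd ` (SIGMA k:UNIV. {n. real n \<in> A k}))"
    using diag_measure_has_sum[of x "\<Union>n. A n"]
    by (rule back_subst[of "\<lambda>S. (_ has_sum _) S"]) force
  moreover have "inj_on snd (SIGMA k:UNIV. {n. real n \<in> A k})"
    using disj by (auto simp: inj_on_def disjoint_family_on_def)
  ultimately have "((\<lambda>(k, n). P n x) has_sum diag_measure (\<Union>n. A n) x)
      (SIGMA k:UNIV. {n. real n \<in> A k})"
    by (simp add: has_sum_reindex o_def case_prod_unfold)
  then have "((\<lambda>k. diag_measure (A k) x) has_sum diag_measure (\<Union>n. A n) x) UNIV"
    by (rule has_sum_SigmaD) (simp add: diag_measure_has_sum)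
  then show "(\<lambda>n. diag_measure (A n) x) sums diag_measure (\<Union>n. A n) x"
    by (rule has_sum_imp_sums)
qed

text \<open>The measure has mass \<open>(norm (P n x))\<^sup>2\<close> at \<open>real n\<close>. The
  form as a pushforward of a density on the naturals turns integrals into series.\<close>

lemma scalar_measure_diag_measure:
  "scalar_measure diag_measure x =
    distr (density (count_space UNIV) (\<lambda>n. ennreal ((norm (P n x))\<^sup>2))) borel real"
    (is "_ = ?M")
proof -
  have emeasure: "emeasure ?M A = ennreal (Re (cinner x (diag_measure A x)))"
    if A: "A \<in> sets borel" for A
  proof -
    have "emeasure ?M A = (\<Sum>n. ennreal ((norm (P n x))\<^sup>2) * indicator (real -` A) n)"
      using A by (simp add: emeasure_distr emeasure_density nn_integral_count_space_nat)
    also have "\<dots> = (\<Sum>n. ennreal (Re (cinner (P n x) (P n (diag_measure A x)))))"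
      by (rule arg_cong[of _ _ suminf])
        (auto simp: fun_eq_iff P_diag_measure cinner_self cinner.zero_right simp flip: of_real_power)
    also have "\<dots> = ennreal (Re (cinner x (diag_measure A x)))"
    proof (rule suminf_ennreal_eq)
      show "0 \<le> Re (cinner (P n x) (P n (diag_measure A x)))" for n
        by (simp add: P_diag_measure cinner_self cinner.zero_right flip: of_real_power)
    qed (intro sums_Re cinner_sums)
    finally show ?thesis .
  qed
  \<comment> \<open>\<open>measure_of\<close> sees the set function only on Borel sets, where it
    agrees with \<open>emeasure ?M\<close>.\<close>
  have "scalar_measure diag_measure x = measure_of (space ?M) (sets ?M) (emeasure ?M)"
    unfolding scalar_measure_def
    using measure_of_eq[of "sets borel" UNIV "\<lambda>A. ennreal (Re (cinner x (diag_measure A x)))"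
        "emeasure ?M"] sets.sigma_sets_eq[of "borel :: real measure"]
    by (auto simp: emeasure)
  then show ?thesis
    by (simp only: measure_of_of_measure)
qed

lemma nn_integral_diag_measure:
  assumes "f \<in> borel_measurable borel"
  shows "(\<integral>\<^sup>+ t. f t \<partial>scalar_measure diag_measure x) = (\<Sum>n. ennreal ((norm (P n x))\<^sup>2) * f (real n))"
  using assms
  by (simp add: scalar_measure_diag_measure nn_integral_distr nn_integral_density
      nn_integral_count_space_nat)

lemma P_simple_spectral_integral:
  assumes "finite (range s)"
  shows "P n (simple_spectral_integral diag_measure s x) = s (real n) *\<^sub>R P n x"
proof -
  have "P n (simple_spectral_integral diag_measure s x) =
      (\<Sum>c\<in>range s. if s (real n) = c then c *\<^sub>R P n x else 0)"
    unfolding simple_spectral_integral_def linear_sum[OF linear_P] linear_scale[OF linear_P]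
    by (intro sum.cong) (auto simp: P_diag_measure)
  also have "\<dots> = s (real n) *\<^sub>R P n x"
    using assms by simp
  finally show ?thesis .
qed

text \<open>Continuity of \<open>P n\<close> identifies the limit of the components as
  \<open>P n y\<close>, while square-mean convergence to \<open>\<Phi>\<close> gives the same limit
  atom by atom.\<close>

lemma spectral_integral_diag_measure_imp:
  assumes \<Phi>: "\<Phi> \<in> borel_measurable borel"
    and xy: "(x, y) \<in> spectral_integral diag_measure \<Phi>"
  shows "P n y = \<Phi> (real n) *\<^sub>R P n x"
proof -
  obtain s where s: "\<And>k. simple_function borel (s k)"
    "(\<lambda>k::nat. \<integral>\<^sup>+ t. ennreal ((s k t - \<Phi> t)\<^sup>2) \<partial>scalar_measure diag_measure x) \<longlonglongrightarrow> 0"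
    "(\<lambda>k. simple_spectral_integral diag_measure (s k) x) \<longlonglongrightarrow> y"
    using xy unfolding spectral_integral_def by auto
  have fin: "finite (range (s k))" for k
    using simple_functionD(1)[OF s(1)] by simp
  have meas: "s k \<in> borel_measurable borel" for k
    by (rule borel_measurable_simple_function[OF s(1)])
  have "(\<lambda>k. P n (simple_spectral_integral diag_measure (s k) x)) \<longlonglongrightarrow> P n y"
    by (rule bounded_linear.tendsto[OF bounded_linear_P s(3)])
  then have 1: "(\<lambda>k. s k (real n) *\<^sub>R P n x) \<longlonglongrightarrow> P n y"
    by (simp add: P_simple_spectral_integral[OF fin])
  \<comment> \<open>One atom contributes at most the whole integral. The scaled vectors are
    compared, since \<open>s k (real n)\<close> itself need not converge where
    \<open>P n x = 0\<close>.\<close>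
  have "ennreal ((norm ((s k (real n) - \<Phi> (real n)) *\<^sub>R P n x))\<^sup>2) \<le>
      (\<integral>\<^sup>+ t. ennreal ((s k t - \<Phi> t)\<^sup>2) \<partial>scalar_measure diag_measure x)" for k
  proof -
    have "ennreal ((norm ((s k (real n) - \<Phi> (real n)) *\<^sub>R P n x))\<^sup>2) =
        (\<Sum>i\<in>{n}. ennreal ((norm (P i x))\<^sup>2) * ennreal ((s k (real i) - \<Phi> (real i))\<^sup>2))"
      by (simp add: power_mult_distrib mult.commute flip: ennreal_mult)
    also have "\<dots> \<le> (\<Sum>i. ennreal ((norm (P i x))\<^sup>2) * ennreal ((s k (real i) - \<Phi> (real i))\<^sup>2))"
      by (rule sum_le_suminf) auto
    also have "\<dots> = (\<integral>\<^sup>+ t. ennreal ((s k t - \<Phi> t)\<^sup>2) \<partial>scalar_measure diag_measure x)"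
      using meas \<Phi> by (intro nn_integral_diag_measure[symmetric]) measurable
    finally show ?thesis .
  qed
  then have "(\<lambda>k. ennreal ((norm ((s k (real n) - \<Phi> (real n)) *\<^sub>R P n x))\<^sup>2)) \<longlonglongrightarrow> 0"
    by (intro tendsto_sandwich[OF _ _ tendsto_const s(2)] always_eventually) auto
  then have "(\<lambda>k. (norm ((s k (real n) - \<Phi> (real n)) *\<^sub>R P n x))\<^sup>2) \<longlonglongrightarrow> 0"
    by (simp flip: ennreal_0)
  then have "(\<lambda>k. s k (real n) *\<^sub>R P n x - \<Phi> (real n) *\<^sub>R P n x) \<longlonglongrightarrow> 0"
    using tendsto_real_sqrt by (fastforce simp: scaleR_diff_left tendsto_norm_zero_iff)
  then show ?thesis
    using LIMSEQ_unique[OF 1] by (simp add: LIM_zero_iff)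
qed

text \<open>The approximating simple functions are the truncations of \<open>\<Phi>\<close> to the first \<open>k\<close> atoms.\<close>

lemma spectral_integral_diag_measureI:
  assumes \<Phi>: "\<Phi> \<in> borel_measurable borel"
    and xy: "\<And>n. P n y = \<Phi> (real n) *\<^sub>R P n x"
  shows "(x, y) \<in> spectral_integral diag_measure \<Phi>"
proof -
  define s where "s k t = (if t \<in> real ` {..<k} then \<Phi> t else 0)" for k t
  have meas [measurable]: "s k \<in> borel_measurable borel" for k
  proof -
    have [measurable]: "real ` {..<k} \<in> sets borel"
      by (intro borel_closed finite_imp_closed) simp
    show ?thesis
      unfolding s_def using \<Phi> by measurable
  qed
  have fin: "finite (range (s k))" for k
    by (rule finite_subset[of _ "insert 0 (\<Phi> ` real ` {..<k})"]) (auto simp: s_def)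
  have simple: "simple_function borel (s k)" for k
    by (rule simple_function_borel_measurable) (use fin in auto)
  \<comment> \<open>With this, the integral of the square of \<open>\<Phi>\<close> is the Parseval
    series of \<open>y\<close>, hence finite.\<close>
  have norm_y: "(norm (P n y))\<^sup>2 = (norm (P n x))\<^sup>2 * (\<Phi> (real n))\<^sup>2" for n
    by (simp add: xy power_mult_distrib)
  have "(\<integral>\<^sup>+ t. ennreal ((\<Phi> t)\<^sup>2) \<partial>scalar_measure diag_measure x) =
      (\<Sum>n. ennreal ((norm (P n x))\<^sup>2) * ennreal ((\<Phi> (real n))\<^sup>2))"
    by (rule nn_integral_diag_measure) (use \<Phi> in measurable)
  also have "\<dots> = (\<Sum>n. ennreal ((norm (P n y))\<^sup>2))"
    by (simp add: norm_y flip: ennreal_mult)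
  also have "\<dots> = ennreal ((norm y)\<^sup>2)"
    by (rule suminf_ennreal_eq[OF _ norm_sums]) simp
  finally have "(\<integral>\<^sup>+ t. ennreal ((\<Phi> t)\<^sup>2) \<partial>scalar_measure diag_measure x) < \<infinity>"
    by simp
  \<comment> \<open>Truncation errs only at atoms \<open>n \<ge> k\<close>, so the error is the tail
    of the Parseval series of \<open>y\<close>.\<close>
  moreover have "(\<lambda>k. \<integral>\<^sup>+ t. ennreal ((s k t - \<Phi> t)\<^sup>2) \<partial>scalar_measure diag_measure x) \<longlonglongrightarrow> 0"
  proof -
    have "(\<integral>\<^sup>+ t. ennreal ((s k t - \<Phi> t)\<^sup>2) \<partial>scalar_measure diag_measure x) =
        ennreal ((norm y)\<^sup>2 - (\<Sum>n<k. (norm (P n y))\<^sup>2))" for k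
    proof -
      have "(\<integral>\<^sup>+ t. ennreal ((s k t - \<Phi> t)\<^sup>2) \<partial>scalar_measure diag_measure x) =
          (\<Sum>n. ennreal ((norm (P n x))\<^sup>2) * ennreal ((s k (real n) - \<Phi> (real n))\<^sup>2))"
        by (rule nn_integral_diag_measure) (use \<Phi> in measurable)
      also have "\<dots> = (\<Sum>n. ennreal ((norm (P n y))\<^sup>2 - (if n \<in> {..<k} then (norm (P n y))\<^sup>2 else 0)))"
        by (rule arg_cong[of _ _ suminf]) (auto simp: fun_eq_iff norm_y s_def simp flip: ennreal_mult)
      also have "\<dots> = ennreal ((norm y)\<^sup>2 - (\<Sum>n<k. (norm (P n y))\<^sup>2))"
        by (intro suminf_ennreal_eq sums_diff norm_sums sums_If_finite_set) auto
      finally show ?thesis .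
    qed
    moreover have "(\<lambda>k. (norm y)\<^sup>2 - (\<Sum>n<k. (norm (P n y))\<^sup>2)) \<longlonglongrightarrow> (norm y)\<^sup>2 - (norm y)\<^sup>2"
      by (intro tendsto_intros norm_sums[unfolded sums_def])
    ultimately show ?thesis
      using tendsto_ennrealI by fastforce
  qed
  moreover have "(\<lambda>k. simple_spectral_integral diag_measure (s k) x) \<longlonglongrightarrow> y"
  proof -
    have "simple_spectral_integral diag_measure (s k) x = (\<Sum>n<k. P n y)" for k
      by (rule P_ext) (auto simp: P_simple_spectral_integral[OF fin] linear_sum[OF linear_P] P_P
          xy s_def linear_scale[OF linear_P] if_distrib[of "scaleR _"] cong: if_cong)
    then show ?thesis
      using P_sums[of y] by (simp add: sums_def)
  qed
  ultimately show ?thesis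
    unfolding spectral_integral_def using simple by auto
qed

lemma spectral_integral_diag_measure:
  assumes "\<Phi> \<in> borel_measurable borel"
  shows "(x, y) \<in> spectral_integral diag_measure \<Phi> \<longleftrightarrow> (\<forall>n. P n y = \<Phi> (real n) *\<^sub>R P n x)"
  using spectral_integral_diag_measure_imp[OF assms] spectral_integral_diag_measureI[OF assms] by blast

text \<open>The operator multiplies the \<open>n\<close>-th component by \<open>n\<close> on its
  maximal domain. Finite partial sums give density; testing the adjoint relation on vectors
  \<open>P n u\<close> recovers the components of \<open>z\<close>, and the converse is
  Parseval.\<close>

lemma selfadjoint_diag: "selfadjoint (spectral_integral diag_measure (\<lambda>t. t))"
proof -
  define T where "T = spectral_integral diag_measure (\<lambda>t. t)"
  have T: "(x, y) \<in> T \<longleftrightarrow> (\<forall>n. P n y = real n *\<^sub>R P n x)" for x y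
    unfolding T_def by (rule spectral_integral_diag_measure) simp
  have "linear_operator T"
    unfolding linear_operator_def
  proof (intro conjI allI impI)
    show "single_valued T"
      by (auto simp: single_valued_def T intro: P_ext)
  qed (simp_all add: T linear_0[OF linear_P] linear_add[OF linear_P] P_scaleC scaleR_add_right
      scaleC_scaleR)
  moreover have "x \<in> closure (Domain T)" for x
  proof -
    have "((\<Sum>n<k. P n x), (\<Sum>n<k. real n *\<^sub>R P n x)) \<in> T" for k
      by (simp add: T linear_sum[OF linear_P] linear_scale[OF linear_P] P_P if_distrib[of "scaleR _"]
          cong: if_cong)
    then have "(\<Sum>n<k. P n x) \<in> Domain T" for k
      by blast
    then show ?thesis
      unfolding closure_sequential
      by (intro exI[of _ "\<lambda>k. \<Sum>n<k. P n x"] conjI allI P_sums[unfolded sums_def])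
  qed
  moreover have "(y, z) \<in> adjoint_operator T \<longleftrightarrow> (y, z) \<in> T" for y z
  proof
    assume adj: "(y, z) \<in> adjoint_operator T"
    show "(y, z) \<in> T"
      unfolding T
    proof (intro allI cinner_ext)
      fix n u
      have "(P n u, real n *\<^sub>R P n u) \<in> T"
        by (simp add: T linear_scale[OF linear_P] P_P)
      then have "cinner y (real n *\<^sub>R P n u) = cinner z (P n u)"
        using adj unfolding adjoint_operator_def by auto
      then show "cinner (P n z) u = cinner (real n *\<^sub>R P n y) u"
        by (simp add: cinner_scaleR_right cinner_scaleR_left orthogonal_projectionD(4)[OF proj])
    qed
  next
    assume yz: "(y, z) \<in> T"
    have "cinner y w = cinner z x" if "(x, w) \<in> T" for x w
    proof -
      have "(\<lambda>n. cinner (P n y) (P n w)) = (\<lambda>n. cinner (P n z) (P n x))"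
        using yz that by (simp add: fun_eq_iff T cinner_scaleR_right cinner_scaleR_left)
      then show ?thesis
        using sums_unique2[OF cinner_sums[of y w]] cinner_sums[of z x] by simp
    qed
    then show "(y, z) \<in> adjoint_operator T"
      unfolding adjoint_operator_def by auto
  qed
  ultimately show ?thesis
    unfolding selfadjoint_def T_def[symmetric] by auto
qed

end

text \<open>The series of the \<open>Q n\<close> converges to a projection \<open>R\<close>. Its
  complement takes index \<open>0\<close>, which shifts each \<open>Q n\<close> to index
  \<open>Suc n\<close>.\<close>

lemma complete_orthogonal_projections:
  fixes Q :: "nat \<Rightarrow> 'a::complex_hilbert_space \<Rightarrow> 'a"
  assumes proj: "\<And>n. orthogonal_projection (Q n)"
    and neq: "\<And>m n x. m \<noteq> n \<Longrightarrow> Q m (Q n x) = 0"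
  obtains P where "projection_resolution P" "\<And>n. P (Suc n) = Q n"
proof -
  note Q = orthogonal_projectionD[OF proj]
  note lin = orthogonal_projection_bounded_linear[OF proj]
  have Q0: "Q n 0 = 0" for n
    by (rule linear_0[OF bounded_linear.linear[OF lin]])
  have QQ: "Q m (Q n x) = (if n = m then Q n x else 0)" for m n x
    by (auto simp: neq Q(3))
  have orth: "pairwise (\<lambda>m n. orthogonal (Q m x) (Q n x)) A" for x A
    by (auto simp: pairwise_def orthogonal_def inner_eq_Re_cinner Q(4) QQ cinner.zero_right)
  \<comment> \<open>Bessel's inequality: the partial sum \<open>s\<close> satisfies
    \<open>(norm s)\<^sup>2 = inner x s\<close>, and Cauchy-Schwarz cancels one factor.\<close>
  have "(\<Sum>n\<in>F. (norm (Q n x))\<^sup>2) \<le> (norm x)\<^sup>2" if F: "finite F" for F x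
  proof -
    have sq: "(norm (\<Sum>n\<in>F. Q n x))\<^sup>2 = (\<Sum>n\<in>F. (norm (Q n x))\<^sup>2)"
      by (rule norm_sum_Pythagorean[OF F orth])
    also have "\<dots> = inner x (\<Sum>n\<in>F. Q n x)"
      unfolding inner_sum_right
      by (simp add: inner_eq_Re_cinner orthogonal_projection_norm_sq[OF proj] del: of_real_power)
    also have "\<dots> \<le> norm x * norm (\<Sum>n\<in>F. Q n x)"
      by (rule norm_cauchy_schwarz)
    finally have "norm (\<Sum>n\<in>F. Q n x) \<le> norm x"
      unfolding power2_eq_square
      by (metis mult_right_le_imp_le norm_ge_zero order_less_le)
    then show ?thesis
      unfolding sq[symmetric] by (rule power_mono) simp
  qed
  then have "(\<lambda>n. Q n x) summable_on UNIV" for x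
    using orthogonal_summable_on[OF orth] by blast
  then have summable: "summable (\<lambda>n. Q n x)" for x
    by (rule summable_on_imp_summable)
  define R where "R x = (\<Sum>n. Q n x)" for x
  have R: "(\<lambda>n. Q n x) sums R x" for x
    unfolding R_def by (rule summable_sums[OF summable])
  \<comment> \<open>Additivity, homogeneity and idempotence of \<open>R\<close> reduce through this
    to termwise identities.\<close>
  have RI: "R x = y" if "(\<lambda>n. Q n x) sums y" for x y
    using sums_unique2[OF R that] .
  have RQ: "R (Q m x) = Q m x" for m x
    by (rule RI) (use sums_If_finite_set[of "{m}" "\<lambda>_. Q m x"] in \<open>simp add: QQ eq_commute\<close>)
  have QR: "Q m (R x) = Q m x" for m x
  proof -
    have "(\<lambda>n. Q m (Q n x)) sums Q m (R x)"
      by (rule bounded_linear.sums[OF lin R])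
    moreover have "(\<lambda>n. Q m (Q n x)) sums Q m x"
      using sums_If_finite_set[of "{m}" "\<lambda>n. Q n x"] by (simp add: QQ)
    ultimately show ?thesis
      by (rule sums_unique2)
  qed
  have R_add: "R (x + y) = R x + R y" for x y
    by (rule RI) (simp add: Q sums_add[OF R R])
  have R_scaleC: "R (c *\<^sub>C x) = c *\<^sub>C R x" for c x
    by (rule RI) (simp add: Q bounded_linear.sums[OF scaleC.bounded_linear_right R])
  have R_R: "R (R x) = R x" for x
    by (rule RI) (simp add: QR R)
  have R_sym: "cinner (R x) y = cinner x (R y)" for x y
    using sums_unique2[OF bounded_linear.sums[OF cinner.bounded_linear_left R[of x], of y]]
      bounded_linear.sums[OF cinner.bounded_linear_right R[of y], of x] by (simp add: Q(4))
  define P where "P n = (case n of 0 \<Rightarrow> \<lambda>x. x - R x | Suc m \<Rightarrow> Q m)" for n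
  have P: "P 0 = (\<lambda>x. x - R x)" "P (Suc m) = Q m" for m
    by (simp_all add: P_def)
  have "R (x - R x) = 0" for x
    using R_add[of "x - R x" "R x"] by (simp add: R_R)
  then have "orthogonal_projection (P 0)"
    unfolding orthogonal_projection_def P
    by (simp add: R_add R_scaleC R_sym scaleC.diff_right cinner.diff_left cinner.diff_right)
  then have "orthogonal_projection (P n)" for n
    using proj by (cases n) (simp_all add: P)
  moreover have "P m (P n x) = 0" if "m \<noteq> n" for m n x
    using that neq linear_diff[OF bounded_linear.linear[OF lin]]
    by (cases m; cases n) (simp_all add: P RQ QR)
  moreover have "(\<lambda>n. P n x) sums x" for x
    using sums_Suc[of "\<lambda>n. P n x" "R x"] R[of x] by (simp add: P)
  ultimately show thesis
    using that[of P] P by (simp add: projection_resolution_def)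
qed

subsection \<open>Gram--Schmidt orthonormalization of a sequence\<close>

text \<open>Vectors that depend linearly on their predecessors are sent to \<open>0\<close>, by \<open>sgn 0 = 0\<close>.\<close>

fun gram_schmidt :: "(nat \<Rightarrow> 'a::real_inner) \<Rightarrow> nat \<Rightarrow> 'a" where
  "gram_schmidt v n = sgn (v n - (\<Sum>i<n. inner (gram_schmidt v i) (v n) *\<^sub>R gram_schmidt v i))"

declare gram_schmidt.simps [simp del]

lemma gram_schmidt_norm: "gram_schmidt v n = 0 \<or> norm (gram_schmidt v n) = 1"
  unfolding gram_schmidt.simps[of v n] by (auto simp: norm_sgn sgn_zero_iff)

text \<open>Covers unit vectors and the degenerate value \<open>0\<close> at once.\<close>

lemma inner_gram_schmidt_self:
  "inner (gram_schmidt v n) x * inner (gram_schmidt v n) (gram_schmidt v n) = inner (gram_schmidt v n) x"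
  using gram_schmidt_norm[of v n] by (auto simp: norm_eq_1)

text \<open>By induction the earlier vectors are mutually orthogonal, so the subtracted sum has the
  same inner product with \<open>gram_schmidt v m\<close> as \<open>v n\<close> has.\<close>

lemma gram_schmidt_orthogonal_less: "m < n \<Longrightarrow> inner (gram_schmidt v m) (gram_schmidt v n) = 0"
proof (induction n arbitrary: m rule: less_induct)
  case (less n)
  let ?g = "gram_schmidt v"
  have orth: "inner (?g m) (?g i) = 0" if "i < n" "i \<noteq> m" for i
    using less.IH[of m i] less.IH[of i m] that less.prems
    by (cases i m rule: linorder_cases) (auto simp: inner_commute)
  have "inner (?g m) (\<Sum>i<n. inner (?g i) (v n) *\<^sub>R ?g i) =
      (\<Sum>i<n. if i = m then inner (?g m) (v n) else 0)"
    unfolding inner_sum_right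
    by (intro sum.cong) (auto simp: orth inner_gram_schmidt_self)
  also have "\<dots> = inner (?g m) (v n)"
    using less.prems by simp
  finally show ?case
    by (simp add: gram_schmidt.simps[of v n] sgn_div_norm inner_diff_right)
qed

lemma gram_schmidt_orthogonal: "m \<noteq> n \<Longrightarrow> inner (gram_schmidt v m) (gram_schmidt v n) = 0"
  by (metis gram_schmidt_orthogonal_less inner_commute linorder_neqE_nat)

text \<open>The last coefficient is the norm of the residual \<open>v n - p\<close>, so the last
  term restores the residual, also when it is zero.\<close>

lemma gram_schmidt_expansion:
  "v n = (\<Sum>i\<le>n. inner (gram_schmidt v i) (v n) *\<^sub>R gram_schmidt v i)"
proof -
  let ?g = "gram_schmidt v"
  define p where "p = (\<Sum>i<n. inner (?g i) (v n) *\<^sub>R ?g i)"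
  have g: "?g n = sgn (v n - p)"
    by (simp add: p_def gram_schmidt.simps[of v n])
  have "inner (?g n) p = 0"
    unfolding p_def inner_sum_right by (intro sum.neutral) (auto simp: gram_schmidt_orthogonal)
  then have "inner (?g n) (v n) = inner (?g n) (v n - p)"
    by (simp add: inner_diff_right)
  also have "\<dots> = norm (v n - p)"
    by (cases "v n = p") (simp_all add: g sgn_div_norm dot_square_norm power2_eq_square)
  finally have "inner (?g n) (v n) *\<^sub>R ?g n = v n - p"
    by (cases "v n = p") (simp_all add: g sgn_div_norm)
  then show ?thesis
    by (simp add: p_def lessThan_Suc_atMost[symmetric])
qed

text \<open>Here \<open>span\<close> is the real span, so real inner products among the
  \<open>v n\<close> persist among the orthonormalized vectors.\<close>

lemma gram_schmidt_in_span: "gram_schmidt v n \<in> span (range v)"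
proof (induction n rule: less_induct)
  case (less n)
  then show ?case
    unfolding gram_schmidt.simps[of v n] sgn_div_norm
    by (intro span_scale span_diff span_sum) (auto intro: span_base)
qed

subsection \<open>Weak sufficiency from real inner products\<close>

text \<open>The vectors whose inner product with a fixed vector is real form a real subspace; this
  is applied to each argument in turn.\<close>

lemma span_cinner_Reals:
  fixes S :: "'a::complex_inner set"
  assumes S: "\<And>x y. x \<in> S \<Longrightarrow> y \<in> S \<Longrightarrow> cinner x y \<in> \<real>"
    and x: "x \<in> span S" and y: "y \<in> span S"
  shows "cinner x y \<in> \<real>"
proof -
  have sub: "subspace {u. cinner z u \<in> \<real>}" for z :: 'a
    by (auto simp: subspace_def cinner.zero_right cinner_add_right cinner_scaleR_right)
  have "cinner s x \<in> \<real>" if "s \<in> S" for s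
    using span_minimal[OF _ sub[of s]] S[OF that] x by blast
  then have "S \<subseteq> {u. cinner x u \<in> \<real>}"
    using cinner_in_Reals_commute by blast
  then show ?thesis
    using span_minimal[OF _ sub[of x]] y by blast
qed

text \<open>A countable dense set of the whole space may miss \<open>S\<close>, so its points are
  replaced by nearby points of \<open>S\<close>.\<close>

lemma separable_dense_sequence:
  fixes S :: "'a::metric_space set"
  assumes sep: "separable_space (euclidean :: 'a topology)" and "S \<noteq> {}"
  obtains v :: "nat \<Rightarrow> 'a" where "range v \<subseteq> S" "S \<subseteq> closure (range v)"
proof -
  obtain C :: "'a set" where C: "countable C" "closure C = UNIV"
    using sep unfolding separable_space_def by auto
  \<comment> \<open>If the ball around \<open>c\<close> misses \<open>S\<close>, any point of
    \<open>S\<close> serves as default.\<close>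
  have "\<forall>c k. \<exists>z. z \<in> S \<and> (S \<inter> ball c (inverse (real (Suc k))) \<noteq> {} \<longrightarrow>
      z \<in> ball c (inverse (real (Suc k))))"
    using \<open>S \<noteq> {}\<close> by blast
  then obtain f where f: "\<And>c k. f c k \<in> S"
    "\<And>c k. S \<inter> ball c (inverse (real (Suc k))) \<noteq> {} \<Longrightarrow> f c k \<in> ball c (inverse (real (Suc k)))"
    by metis
  define D where "D = (\<lambda>(c, k). f c k) ` (C \<times> UNIV)"
  have "C \<noteq> {}"
    using C by auto
  then have D: "D \<noteq> {}" "countable D"
    using C by (auto simp: D_def)
  have "x \<in> closure D" if x: "x \<in> S" for x
    unfolding closure_approachable
  proof (intro allI impI)
    fix \<epsilon> :: real assume "\<epsilon> > 0"
    then obtain k where k: "inverse (real (Suc k)) < \<epsilon> / 2"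
      using reals_Archimedean[of "\<epsilon> / 2"] by auto
    have "x \<in> closure C"
      using C by simp
    then obtain c where c: "c \<in> C" "dist c x < inverse (real (Suc k))"
      unfolding closure_approachable by (metis inverse_positive_iff_positive of_nat_0_less_iff zero_less_Suc)
    \<comment> \<open>The ball meets \<open>S\<close> at \<open>x\<close>, so \<open>f c k\<close>
      was chosen in it and lies within twice the radius of \<open>x\<close>.\<close>
    then have "f c k \<in> ball c (inverse (real (Suc k)))"
      using x by (intro f(2)) auto
    then have "dist (f c k) x < \<epsilon>"
      using c k dist_triangle[of "f c k" x c] by (simp add: dist_commute)
    then show "\<exists>y\<in>D. dist y x < \<epsilon>"
      using c by (auto simp: D_def)
  qed
  moreover have "D \<subseteq> S"
    using f by (auto simp: D_def)
  ultimately show thesis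
    using that[of "from_nat_into D"] D by auto
qed

text \<open>With \<open>b\<close> the orthonormalization of a dense sequence in \<open>S\<close>, the operator has eigenvalue
  \<open>n + 1\<close> at \<open>b n\<close> and \<open>0\<close> on the complement, and \<open>\<omega> = (\<Sum>n. 2\<^sup>-\<^sup>n b n)\<close>; the value of \<open>\<Phi> x\<close> at
  \<open>n + 1\<close> is the real Fourier coefficient of \<open>x\<close> divided by that of \<open>\<omega>\<close>.\<close>

lemma real_cinner_imp_functions_of_operator:
  fixes S :: "'a::complex_hilbert_space set"
  assumes sep: "separable_space (euclidean :: 'a topology)"
    and S: "\<And>x y. x \<in> S \<Longrightarrow> y \<in> S \<Longrightarrow> cinner x y \<in> \<real>"
  obtains e T \<omega> and \<Phi> :: "'a \<Rightarrow> real \<Rightarrow> real"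
  where "selfadjoint T" "is_spectral_measure_of e T"
    "\<And>x. \<Phi> x \<in> borel_measurable borel"
    "\<And>x. x \<in> S \<Longrightarrow> (\<omega>, x) \<in> spectral_integral e (\<Phi> x)"
proof -
  \<comment> \<open>Inserting \<open>0\<close> covers an empty \<open>S\<close> and leaves the real
    span unchanged.\<close>
  obtain v :: "nat \<Rightarrow> 'a" where v: "range v \<subseteq> insert 0 S" "insert 0 S \<subseteq> closure (range v)"
    by (rule separable_dense_sequence[OF sep insert_not_empty])
  define b where "b = gram_schmidt v"
  have "span (range v) \<subseteq> span S"
    using span_mono[OF v(1)] by simp
  then have b_span: "b n \<in> span S" for n
    using gram_schmidt_in_span by (auto simp: b_def)
  \<comment> \<open>On the real span of \<open>S\<close> the two inner products agree, which
    upgrades the orthogonality from Gram-Schmidt to the complex form.\<close>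
  have cinner_b: "cinner (b n) x = of_real (inner (b n) x)" if "x \<in> span S" for n x
    by (intro cinner_in_Reals_eq span_cinner_Reals[OF _ b_span that]) (rule S)
  have b_orth: "cinner (b m) (b n) = 0" if "m \<noteq> n" for m n
    using that by (simp add: cinner_b[OF b_span]) (simp add: b_def gram_schmidt_orthogonal)
  have b_self: "cinner (b n) (b n) *\<^sub>C b n = b n" for n
    using gram_schmidt_norm[of v n] by (auto simp: b_def cinner_self scaleC.zero_right)
  define Q where "Q n x = cinner (b n) x *\<^sub>C b n" for n x
  have "orthogonal_projection (Q n)" for n
    unfolding orthogonal_projection_def Q_def
  proof (intro conjI allI)
    fix x y
    show "cinner (b n) (cinner (b n) x *\<^sub>C b n) *\<^sub>C b n = cinner (b n) x *\<^sub>C b n"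
      by (simp add: cinner_scaleC_right b_self flip: scaleC_scaleC)
    show "cinner (cinner (b n) x *\<^sub>C b n) y = cinner x (cinner (b n) y *\<^sub>C b n)"
      by (simp add: cinner_scaleC_left cinner_scaleC_right cinner_commute[of x "b n"])
  qed (simp_all add: cinner_add_right cinner_scaleC_right scaleC_add_left scaleC_scaleC)
  moreover have "Q m (Q n x) = 0" if "m \<noteq> n" for m n x
    by (simp add: Q_def cinner_scaleC_right b_orth[OF that] scaleC.zero_left)
  ultimately obtain P where "projection_resolution P" and P_Suc: "\<And>n. P (Suc n) = Q n"
    using complete_orthogonal_projections[of Q] by metis
  interpret projection_resolution P by fact
  have Qb: "Q m (b n) = (if m = n then b n else 0)" for m n
    by (simp add: Q_def b_self b_orth scaleC.zero_left)
  have P0b: "P 0 (b n) = 0" for n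
    using P_P_neq[of 0 "Suc n" "b n"] by (simp add: P_Suc Qb)
  have P0v: "P 0 (v n) = 0" for n
    by (subst gram_schmidt_expansion)
      (simp add: linear_sum[OF linear_P] linear_scale[OF linear_P] P0b flip: b_def)
  \<comment> \<open>The kernel of \<open>P 0\<close> is closed and contains the sequence
    \<open>v\<close>, whose closure contains \<open>S\<close>.\<close>
  have P0S: "P 0 x = 0" if "x \<in> S" for x
  proof -
    have "closed {x. P 0 x = 0}"
      by (intro closed_Collect_eq bounded_linear.continuous_on[OF bounded_linear_P] continuous_intros)
    then have "closure (range v) \<subseteq> {x. P 0 x = 0}"
      by (intro closure_minimal) (auto simp: P0v)
    then show ?thesis
      using v(2) that by auto
  qed
  have b_le: "norm (b n) \<le> 1" for n
    using gram_schmidt_norm[of v n] by (auto simp: b_def)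
  have "summable (\<lambda>n. (1 / 2) ^ n *\<^sub>R b n)"
    by (rule summable_comparison_test'[of "\<lambda>n. (1 / 2) ^ n"]) (auto simp: b_le intro: mult_left_le)
  then obtain \<omega> where \<omega>: "(\<lambda>n. (1 / 2) ^ n *\<^sub>R b n) sums \<omega>"
    by (auto simp: summable_def)
  have P\<omega>: "(\<lambda>n. (1 / 2) ^ n *\<^sub>R P m (b n)) sums P m \<omega>" for m
    using bounded_linear.sums[OF bounded_linear_P \<omega>] by (simp add: linear_scale[OF linear_P])
  have P0\<omega>: "P 0 \<omega> = 0"
    by (rule sums_unique2[OF P\<omega>[of 0]]) (simp add: P0b)
  have Q\<omega>: "Q m \<omega> = (1 / 2) ^ m *\<^sub>R b m" for m
  proof -
    have "(\<lambda>n. if n \<in> {m} then (1 / 2) ^ n *\<^sub>R b n else 0) =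
        (\<lambda>n. (1 / 2) ^ n *\<^sub>R P (Suc m) (b n))"
      by (auto simp: P_Suc Qb fun_eq_iff)
    then have "(\<lambda>n. if n \<in> {m} then (1 / 2) ^ n *\<^sub>R b n else 0) sums Q m \<omega>"
      using P\<omega>[of "Suc m"] by (simp only: P_Suc)
    from sums_unique2[OF this sums_If_finite_set] show ?thesis
      by simp
  qed
  \<comment> \<open>Index \<open>Suc m\<close> belongs to \<open>b m\<close>, and
    \<open>2 ^ m\<close> undoes the weight in \<open>\<omega>\<close>. At index \<open>0\<close> any
    value would do, because \<open>P 0\<close> annihilates \<open>\<omega>\<close> and all of
    \<open>S\<close>.\<close>
  define g where "g x n = (case n of 0 \<Rightarrow> 0 | Suc m \<Rightarrow> 2 ^ m * inner (b m) x)" for x n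
  \<comment> \<open>Rounding down extends the sequence \<open>g x\<close> to a Borel function on the
    line that takes the value \<open>g x n\<close> at \<open>real n\<close>.\<close>
  define \<Phi> where "\<Phi> x t = g x (nat \<lfloor>t\<rfloor>)" for x and t :: real
  have meas: "\<Phi> x \<in> borel_measurable borel" for x
    unfolding \<Phi>_def by measurable
  have "(\<omega>, x) \<in> spectral_integral diag_measure (\<Phi> x)" if x: "x \<in> S" for x
  proof (rule spectral_integral_diag_measureI[OF meas])
    fix n
    show "P n x = \<Phi> x (real n) *\<^sub>R P n \<omega>"
    proof (cases n)
      case 0
      then show ?thesis
        by (simp add: P0S[OF x] P0\<omega>)
    next
      case (Suc m)
      have "P n x = inner (b m) x *\<^sub>R b m"
        by (simp add: Suc P_Suc Q_def cinner_b span_base[OF x] scaleC_of_real)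
      also have "\<dots> = \<Phi> x (real n) *\<^sub>R P n \<omega>"
        by (simp add: Suc P_Suc Q\<omega> \<Phi>_def g_def power_one_over nat_add_distrib field_simps
            del: of_nat_Suc)
      finally show ?thesis .
    qed
  qed
  note member = this
  show thesis
  proof (rule that[OF selfadjoint_diag])
    show "is_spectral_measure_of diag_measure (spectral_integral diag_measure (\<lambda>t. t))"
      by (simp add: is_spectral_measure_of_def spectral_measure_diag_measure)
  qed (fact meas, fact member)
qed

theorem theorem3:
  fixes \<Theta> :: "'i set" and \<phi> :: "'i \<Rightarrow> 'a::complex_hilbert_space"
  assumes "separable_space (euclidean :: 'a topology)"
    and "\<forall>\<theta>\<in>\<Theta>. norm (\<phi> \<theta>) = 1"
  shows "(\<exists>T. selfadjoint T \<and> weakly_sufficient T \<Theta> \<phi>) \<longleftrightarrow>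
    (\<exists>\<phi>'. (\<forall>\<theta>\<in>\<Theta>. is_version (\<phi>' \<theta>) (\<phi> \<theta>)) \<and>
      (\<forall>\<theta>'\<in>\<Theta>. \<forall>\<theta>''\<in>\<Theta>. cinner (\<phi>' \<theta>') (\<phi>' \<theta>'') \<in> \<real>))"
proof
  assume "\<exists>T. selfadjoint T \<and> weakly_sufficient T \<Theta> \<phi>"
  then obtain e \<Phi> \<xi> \<phi>' where e: "spectral_measure e"
    and \<phi>': "\<forall>\<theta>\<in>\<Theta>. is_version (\<phi>' \<theta>) (\<phi> \<theta>) \<and> (\<xi>, \<phi>' \<theta>) \<in> spectral_integral e (\<Phi> \<theta>)"
    unfolding weakly_sufficient_def is_spectral_measure_of_def by blast
  then show "\<exists>\<phi>'. (\<forall>\<theta>\<in>\<Theta>. is_version (\<phi>' \<theta>) (\<phi> \<theta>)) \<and>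
      (\<forall>\<theta>'\<in>\<Theta>. \<forall>\<theta>''\<in>\<Theta>. cinner (\<phi>' \<theta>') (\<phi>' \<theta>'') \<in> \<real>)"
    using spectral_integral_cinner_Reals[OF e] by blast
next
  assume "\<exists>\<phi>'. (\<forall>\<theta>\<in>\<Theta>. is_version (\<phi>' \<theta>) (\<phi> \<theta>)) \<and>
      (\<forall>\<theta>'\<in>\<Theta>. \<forall>\<theta>''\<in>\<Theta>. cinner (\<phi>' \<theta>') (\<phi>' \<theta>'') \<in> \<real>)"
  then obtain \<phi>' where version: "\<forall>\<theta>\<in>\<Theta>. is_version (\<phi>' \<theta>) (\<phi> \<theta>)"
    and real: "\<And>x y. x \<in> \<phi>' ` \<Theta> \<Longrightarrow> y \<in> \<phi>' ` \<Theta> \<Longrightarrow> cinner x y \<in> \<real>"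
    by blast
  show "\<exists>T. selfadjoint T \<and> weakly_sufficient T \<Theta> \<phi>"
  proof (rule real_cinner_imp_functions_of_operator[OF assms(1) real])
    fix e T \<omega> and \<Phi> :: "'a \<Rightarrow> real \<Rightarrow> real"
    assume T: "selfadjoint T" "is_spectral_measure_of e T"
      and \<Phi>: "\<And>x. \<Phi> x \<in> borel_measurable borel"
        "\<And>x. x \<in> \<phi>' ` \<Theta> \<Longrightarrow> (\<omega>, x) \<in> spectral_integral e (\<Phi> x)"
    \<comment> \<open>The functions obtained are indexed by vectors; composing with
      \<open>\<phi>'\<close> indexes them by parameters.\<close>
    have "\<forall>\<theta>\<in>\<Theta>. \<Phi> (\<phi>' \<theta>) \<in> borel_measurable borel \<and> is_version (\<phi>' \<theta>) (\<phi> \<theta>) \<and>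
        (\<omega>, \<phi>' \<theta>) \<in> spectral_integral e (\<Phi> (\<phi>' \<theta>))"
      using version \<Phi> by simp
    then have "weakly_sufficient T \<Theta> \<phi>"
      unfolding weakly_sufficient_def using T(2)
      by (intro exI[of _ e] exI[of _ "\<lambda>\<theta>. \<Phi> (\<phi>' \<theta>)"] exI[of _ \<omega>] exI[of _ \<phi>'] conjI)
    then show ?thesis
      using T(1) by blast
  qed
qed

end
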